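(* Let $\Pi_q$ be a projective plane of order $q$, where $q$ is a prime power, and let $\mathcal S$ be a generalized KM-arc of type $(0,m,t)$ in $\Pi_q$ having no $0$-secants. Then $\mathcal S$ is one of the following: a set of $q+1$ collinear points ($m=1$); a unital ($t=1$, $m=\sqrt q+1$); the complement of a Baer subplane ($t=q-\sqrt q$, $m=q$); the complement of a point ($t=q$, $m=q+1$).
   Context: A generalized KM-arc of type $(0,m,t)$ in a projective plane of order $q$ is a proper non-empty subset $\mathcal S$ of the points with $|\mathcal S|=q(m-1)+t$ such that every line meets $\mathcal S$ in $0$, $m$ or $t$ points. A $0$-secant is a line disjoint from $\mathcal S$. A unital is a set of $q\sqrt q+1$ points meeting every line in $1$ or $\sqrt q+1$ points; a Baer subplane is a subplane of order $\sqrt q$. *)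

theory Defs
  imports Complex_Main "HOL-Number_Theory.Prime_Powers"
begin

text \<open>Lines are represented by their sets of points.\<close>

locale projective_plane =
  fixes points :: "'a set" and lines :: "'a set set"
  assumes lines_subset: "l \<in> lines \<Longrightarrow> l \<subseteq> points"
    and unique_join:
      "\<lbrakk>x \<in> points; y \<in> points; x \<noteq> y\<rbrakk> \<Longrightarrow> \<exists>!l. l \<in> lines \<and> x \<in> l \<and> y \<in> l"
    and unique_meet:
      "\<lbrakk>k \<in> lines; l \<in> lines; k \<noteq> l\<rbrakk> \<Longrightarrow> \<exists>!x. x \<in> points \<and> x \<in> k \<and> x \<in> l"
    and quadrangle:
      "\<exists>Q \<subseteq> points. card Q = 4 \<and> (\<forall>l \<in> lines. card (Q \<inter> l) \<le> 2)"

text \<open>Since \<open>q + 1 > 0\<close>, the condition on \<open>card\<close> forces lines, and hence the plane, to be finite.\<close>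

definition projective_plane_of_order :: "'a set \<Rightarrow> 'a set set \<Rightarrow> nat \<Rightarrow> bool" where
  "projective_plane_of_order P L q \<longleftrightarrow>
     projective_plane P L \<and> (\<forall>l \<in> L. card l = q + 1)"

text \<open>The size condition is stated over the integers, as \<open>m - 1\<close> would be truncated on \<open>nat\<close>.\<close>

definition generalized_KM_arc ::
  "'a set \<Rightarrow> 'a set set \<Rightarrow> nat \<Rightarrow> nat \<Rightarrow> nat \<Rightarrow> 'a set \<Rightarrow> bool" where
  "generalized_KM_arc P L q m t S \<longleftrightarrow>
     S \<subset> P \<and> S \<noteq> {} \<and>
     int (card S) = int q * (int m - 1) + int t \<and>
     (\<forall>l \<in> L. card (l \<inter> S) \<in> {0, m, t})"

definition zero_secant :: "'a set set \<Rightarrow> 'a set \<Rightarrow> 'a set \<Rightarrow> bool" where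
  "zero_secant L S l \<longleftrightarrow> l \<in> L \<and> l \<inter> S = {}"

definition collinear_points :: "'a set set \<Rightarrow> 'a set \<Rightarrow> bool" where
  "collinear_points L S \<longleftrightarrow> (\<exists>l \<in> L. S \<subseteq> l)"

definition unital :: "'a set \<Rightarrow> 'a set set \<Rightarrow> nat \<Rightarrow> 'a set \<Rightarrow> bool" where
  "unital P L q U \<longleftrightarrow>
     U \<subseteq> P \<and>
     real (card U) = real q * sqrt (real q) + 1 \<and>
     (\<forall>l \<in> L. real (card (l \<inter> U)) \<in> {1, sqrt (real q) + 1})"

text \<open>
  A subplane is given by a set \<open>B\<close> of points and a set \<open>M\<close> of lines of the ambient plane that form
  a projective plane under the induced incidence, i.e. with each line \<open>l\<close> of \<open>M\<close> replaced by its
  trace \<open>l \<inter> B\<close>.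
\<close>

definition subplane_of_order :: "'a set \<Rightarrow> 'a set set \<Rightarrow> nat \<Rightarrow> 'a set \<Rightarrow> bool" where
  "subplane_of_order P L n B \<longleftrightarrow>
     B \<subseteq> P \<and> (\<exists>M \<subseteq> L. projective_plane_of_order B ((\<lambda>l. l \<inter> B) ` M) n)"

definition baer_subplane :: "'a set \<Rightarrow> 'a set set \<Rightarrow> nat \<Rightarrow> 'a set \<Rightarrow> bool" where
  "baer_subplane P L q B \<longleftrightarrow>
     (\<exists>n. real n = sqrt (real q) \<and> subplane_of_order P L n B)"

end

theory Submission
  imports Defs
begin

text \<open>
  Counting \<open>S\<close> along the lines through a point shows that a point of \<open>S\<close> lies on exactly one
  \<open>t\<close>-secant, and a point outside \<open>S\<close> on \<open>e + 1\<close> of them, where \<open>e (m - t) = q\<close>.  If \<open>m < t\<close> this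
  forces \<open>S\<close> to be a line.  Otherwise put \<open>d = m - t\<close>, so that \<open>q = d e\<close>.  The \<open>t\<close>-secants partition
  \<open>S\<close>, and counting them also by their intersections with a fixed one gives the Diophantine equation
  \<open>t\<^sup>2 + t d + d\<^sup>2 = t d e + t + d\<close>.  Hence \<open>d\<close> divides \<open>t (t - 1)\<close>; being a prime power, \<open>d\<close> divides
  \<open>t\<close> or \<open>t - 1\<close>, and since \<open>t\<close> divides \<open>d (d - 1)\<close> only the listed parameters survive.  In the Baer
  case the lines of the subplane are the \<open>t\<close>-secants: two of them cannot meet inside \<open>S\<close>.
\<close>

section \<open>Arithmetic of the parameters\<close>

lemma prime_power_dvd_consecutive:
  fixes d t :: nat
  assumes "primepow q" "d dvd q" "d dvd t * (t - 1)" "t > 0"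
  shows "d dvd t \<or> d dvd t - 1"
proof -
  obtain p n where p: "prime p" "q = p ^ n"
    using assms(1) by (auto simp: primepow_def)
  obtain i where d: "d = p ^ i"
    using assms(2) p divides_primepow_nat by blast
  \<comment> \<open>The prime \<open>p\<close> divides at most one of two consecutive numbers, so
    the power \<open>d\<close> of \<open>p\<close> is coprime to one factor and must divide the
    other.\<close>
  have "coprime t (t - 1)"
    using assms(4) by (metis coprime_diff_one_left_nat coprime_commute)
  then consider "\<not> p dvd t" | "\<not> p dvd t - 1"
    using p(1) by (meson coprime_common_divisor not_prime_unit)
  then show ?thesis
  proof cases
    case 1
    then have "coprime d t"
      unfolding d using p(1) by (metis coprime_power_left_iff prime_imp_coprime)
    then show ?thesis
      using assms(3) coprime_dvd_mult_right_iff by blast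
  next
    case 2
    then have "coprime d (t - 1)"
      unfolding d using p(1) by (metis coprime_power_left_iff prime_imp_coprime)
    then show ?thesis
      using assms(3) coprime_dvd_mult_left_iff by blast
  qed
qed

text \<open>With \<open>q = d * e\<close> and \<open>m = t + d\<close>, the three outcomes are in
  turn the parameters of the complement of a point, of a unital and of the complement of a Baer
  subplane.\<close>

lemma KM_parameters:
  fixes d e t :: nat
  assumes pp: "primepow (d * e)" and t: "t > 0" and d: "d > 0"
    and eq: "t * t + t * d + d * d = t * d * e + t + d"
  shows "(d = 1 \<and> t = e) \<or> (t = 1 \<and> e = d) \<or> (d \<ge> 2 \<and> e = d \<and> t = d * (d - 1))"
proof (cases "d = 1")
  case True
  then show ?thesis using eq t by simp
next
  case False
  then have d2: "d \<ge> 2" using d by simp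
  have eqi: "int t * int t + int t * int d + int d * int d = int t * int d * int e + int t + int d"
    using arg_cong[OF eq, of int] by simp
  \<comment> \<open>Collecting the multiples of \<open>d\<close>, and below those of
    \<open>t\<close>, exhibits the cofactors. They are formed over the integers, where their
    subtractions cannot truncate.\<close>
  have "int d * (int t * int e + 1 - int t - int d) = int (t * (t - 1))"
    using eqi t by (simp add: of_nat_diff algebra_simps)
  then have "d dvd t * (t - 1)"
    by (metis dvd_triv_left int_dvd_int_iff)
  moreover have "int t * (int d * int e + 1 - int t - int d) = int (d * (d - 1))"
    using eqi d by (simp add: of_nat_diff algebra_simps)
  then have tdvd: "t dvd d * (d - 1)"
    by (metis dvd_triv_left int_dvd_int_iff)
  ultimately consider "d dvd t" | "d dvd t - 1"
    using prime_power_dvd_consecutive[OF pp, of d t] t by auto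
  then show ?thesis
  proof cases
    case 1
    then obtain s where s: "t = d * s" by blast
    have s0: "s > 0" using t s by (cases s) auto
    have "int d * (int s * (int d * int s) + int s * int d + int d)
        = int d * (int s * int d * int e + int s + 1)"
      using eqi unfolding s by (simp add: algebra_simps)
    then have eq': "int s * (int d * int s) + int s * int d + int d = int s * int d * int e + int s + 1"
      using d by simp
    \<comment> \<open>Cancelling \<open>d\<close> in \<open>tdvd\<close> bounds \<open>s\<close>
      from above by \<open>d - 1\<close>; reading \<open>eq'\<close> modulo \<open>d\<close> then
      gives the same bound from below.\<close>
    have "s dvd d - 1"
      using tdvd s d by simp
    then have "s \<le> d - 1" using d2 by (simp add: dvd_imp_le)
    moreover have "int (s + 1) = int d * (int s * int s + int s + 1 - int s * int e)"
      using eq' by (simp add: algebra_simps)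
    then have "d dvd s + 1"
      by (metis dvd_triv_left int_dvd_int_iff)
    then have "d \<le> s + 1" by (simp add: dvd_imp_le)
    ultimately have sd: "s = d - 1" using d2 by simp
    then have si: "int d = int s + 1" using d by simp
    \<comment> \<open>Since \<open>d = s + 1\<close>, the terms \<open>d\<close> and
      \<open>s + 1\<close> of \<open>eq'\<close> cancel, and the rest of its left side is
      \<open>s * d * (s + 1)\<close>.\<close>
    have "int s * int d * int e = int s * int d * int d"
      using eq' unfolding si by (simp add: algebra_simps)
    then have "e = d" using s0 d by simp
    then show ?thesis using s sd d2 by simp
  next
    case 2
    then obtain s where "t - 1 = d * s" by blast
    then have s: "t = d * s + 1" using t by simp
    \<comment> \<open>Coprimality pushes the divisor \<open>t\<close> of \<open>d * (d - 1)\<close>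
      into \<open>d - 1\<close>; then \<open>t < d\<close> leaves only \<open>s = 0\<close>.\<close>
    have "coprime t d"
      unfolding s by (metis coprime_Suc_left_nat coprime_commute coprime_mult_left_iff Suc_eq_plus1)
    then have "t dvd d - 1"
      using tdvd coprime_dvd_mult_right_iff by blast
    then have "t \<le> d - 1" using d2 by (simp add: dvd_imp_le)
    then have "d * s + 1 < d" using s d by simp
    then have "s = 0" by (cases s) auto
    then have "t = 1" using s by simp
    then show ?thesis using eq d by simp
  qed
qed

section \<open>Incidence in projective planes\<close>

context projective_plane
begin

lemma line_eqI:
  assumes "k \<in> lines" "l \<in> lines" "x \<noteq> y" "x \<in> k" "y \<in> k" "x \<in> l" "y \<in> l"
  shows "k = l"
  using assms unique_join[of x y] lines_subset by blast

lemma meet_eqI: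
  assumes "k \<in> lines" "l \<in> lines" "k \<noteq> l" "x \<in> k" "y \<in> k" "x \<in> l" "y \<in> l"
  shows "x = y"
  using assms line_eqI by blast

text \<open>Three points \<open>a\<close>, \<open>b\<close>, \<open>c\<close> of the quadrangle
  differ from \<open>x\<close> and are not collinear. The lines \<open>ab\<close> and
  \<open>ac\<close> meet only in \<open>a\<close>, so \<open>x\<close> misses one of them.\<close>

lemma line_avoiding_point:
  assumes "x \<in> points"
  obtains l where "l \<in> lines" "x \<notin> l"
proof -
  obtain Q where Q: "Q \<subseteq> points" "card Q = 4" "\<forall>l \<in> lines. card (Q \<inter> l) \<le> 2"
    using quadrangle by blast
  have "finite Q" using Q(2) by (metis card.infinite zero_neq_numeral)
  then have "card (Q - {x}) \<ge> 3"
    using Q(2) by (simp add: card_Diff_singleton_if)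
  then obtain A where "A \<subseteq> Q - {x}" "card A = 3"
    using obtain_subset_with_card_n by metis
  then obtain a b c where abc: "{a, b, c} \<subseteq> Q - {x}" "a \<noteq> b" "b \<noteq> c" "a \<noteq> c"
    by (auto simp: card_3_iff)
  obtain k where k: "k \<in> lines" "a \<in> k" "b \<in> k"
    using abc Q(1) unique_join[of a b] by blast
  obtain l where l: "l \<in> lines" "a \<in> l" "c \<in> l"
    using abc Q(1) unique_join[of a c] by blast
  have "c \<notin> k"
  proof
    assume "c \<in> k"
    then have "{a, b, c} \<subseteq> Q \<inter> k" using k abc by blast
    then have "card {a, b, c} \<le> card (Q \<inter> k)"
      using \<open>finite Q\<close> by (intro card_mono) auto
    moreover have "card {a, b, c} = 3" using abc by simp
    ultimately show False using Q(3) k(1) by fastforce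
  qed
  then have "x \<notin> k \<or> x \<notin> l"
    using meet_eqI[of k l x a] k l abc by blast
  then show ?thesis using that k(1) l(1) by blast
qed

definition pencil :: "'a \<Rightarrow> 'a set set" where
  "pencil x = {l \<in> lines. x \<in> l}"

text \<open>This is projection from \<open>x\<close>. The description is well defined because a line
  through \<open>x\<close> is different from \<open>l\<close> and hence meets it in exactly one
  point.\<close>

lemma bij_betw_pencil:
  assumes "x \<in> points" "l \<in> lines" "x \<notin> l"
  shows "bij_betw (\<lambda>k. THE y. y \<in> k \<and> y \<in> l) (pencil x) l"
proof -
  define f where "f k = (THE y. y \<in> k \<and> y \<in> l)" for k
  have f: "f k = y" if "k \<in> lines" "x \<in> k" "y \<in> k" "y \<in> l" for k y
    unfolding f_def using that assms meet_eqI[of k l] by (intro the_equality) blast+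
  have fk: "f k \<in> k" "f k \<in> l" if k: "k \<in> lines" "x \<in> k" for k
  proof -
    obtain y where "y \<in> k" "y \<in> l"
      using unique_meet[of k l] k assms by blast
    then show "f k \<in> k" "f k \<in> l" using f[OF k] by auto
  qed
  have "inj_on f (pencil x)"
  proof (rule inj_onI)
    fix j k assume jk: "j \<in> pencil x" "k \<in> pencil x" "f j = f k"
    then have "f j \<in> j" "f j \<in> k" "f j \<noteq> x"
      using fk[of j] fk[of k] assms(3) unfolding pencil_def by auto
    then show "j = k"
      using line_eqI[of j k x "f j"] jk unfolding pencil_def by simp
  qed
  moreover have "f ` pencil x \<subseteq> l"
    using fk unfolding pencil_def by blast
  moreover have "y \<in> f ` pencil x" if "y \<in> l" for y
  proof -
    have "y \<in> points" "x \<noteq> y"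
      using lines_subset assms that by auto
    then obtain k where k: "k \<in> lines" "x \<in> k" "y \<in> k"
      using unique_join[OF assms(1)] by blast
    then have "f k = y" using f that by simp
    then show ?thesis using k unfolding pencil_def by blast
  qed
  ultimately have "bij_betw f (pencil x) l"
    unfolding bij_betw_def by blast
  then show ?thesis
    unfolding f_def .
qed

end

section \<open>Counting along pencils in a finite plane\<close>

locale finite_projective_plane = projective_plane +
  fixes q :: nat
  assumes card_line: "l \<in> lines \<Longrightarrow> card l = q + 1"
begin

lemma finite_line: "l \<in> lines \<Longrightarrow> finite l"
  using card_line by (metis add_is_0 card.infinite one_neq_zero)

lemma card_pencil:
  assumes "x \<in> points"
  shows "card (pencil x) = q + 1" "finite (pencil x)"
proof -
  obtain l where l: "l \<in> lines" "x \<notin> l"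
    using line_avoiding_point assms by blast
  note bij = bij_betw_pencil[OF assms l]
  show "card (pencil x) = q + 1"
    using bij_betw_same_card[OF bij] card_line l by simp
  show "finite (pencil x)"
    using bij_betw_finite[OF bij] finite_line l by simp
qed

lemma points_minus_eq_UN_pencil:
  assumes "x \<in> points"
  shows "points - {x} = (\<Union>l \<in> pencil x. l - {x})"
proof
  show "points - {x} \<subseteq> (\<Union>l \<in> pencil x. l - {x})"
  proof
    fix y assume "y \<in> points - {x}"
    then obtain l where "l \<in> lines" "x \<in> l" "y \<in> l" "y \<noteq> x"
      using unique_join[OF assms, of y] by blast
    then show "y \<in> (\<Union>l \<in> pencil x. l - {x})"
      unfolding pencil_def by blast
  qed
qed (use lines_subset in \<open>auto simp: pencil_def\<close>)

lemma finite_points: "finite points"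
proof (cases "points = {}")
  case False
  then obtain x where x: "x \<in> points" by blast
  have "finite (points - {x})"
    unfolding points_minus_eq_UN_pencil[OF x]
    using card_pencil[OF x] finite_line by (auto simp: pencil_def)
  then show ?thesis by simp
qed simp

lemma finite_lines: "finite lines"
  by (rule finite_subset[of _ "Pow points"]) (use finite_points lines_subset in auto)

text \<open>The lines through \<open>x\<close> partition the remaining points; \<open>x\<close>
  itself is removed because it lies on all of them.\<close>

lemma card_Diff_eq_sum_pencil:
  assumes "x \<in> points" "S \<subseteq> points"
  shows "card (S - {x}) = (\<Sum>l \<in> pencil x. card (l \<inter> S - {x}))"
proof -
  have "S - {x} = (\<Union>l \<in> pencil x. l \<inter> S - {x})"
    using points_minus_eq_UN_pencil[OF assms(1)] assms(2) by blast
  moreover have "card (\<Union>l \<in> pencil x. l \<inter> S - {x}) = (\<Sum>l \<in> pencil x. card (l \<inter> S - {x}))"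
  proof (rule card_UN_disjoint)
    show "\<forall>k \<in> pencil x. \<forall>l \<in> pencil x. k \<noteq> l \<longrightarrow> (k \<inter> S - {x}) \<inter> (l \<inter> S - {x}) = {}"
      using meet_eqI unfolding pencil_def by blast
  qed (use card_pencil[OF assms(1)] finite_line in \<open>auto simp: pencil_def\<close>)
  ultimately show ?thesis by simp
qed

end

section \<open>KM-arcs without 0-secants\<close>

locale KM_arc_without_zero_secants = finite_projective_plane +
  fixes m t :: nat and S :: "'a set"
  assumes S_psubset: "S \<subset> points" and S_nonempty: "S \<noteq> {}"
    and card_S: "int (card S) = int q * (int m - 1) + int t"
    and secant_cases: "l \<in> lines \<Longrightarrow> card (l \<inter> S) \<in> {m, t}"
    and secant_pos: "l \<in> lines \<Longrightarrow> card (l \<inter> S) > 0"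
    and q_pos: "q > 0"
begin

definition t_secants :: "'a set set" where
  "t_secants = {l \<in> lines. card (l \<inter> S) = t}"

text \<open>Splitting \<open>t - c\<close> as \<open>(t - m) + (m - c)\<close> isolates the number
  of t-secants through \<open>x\<close>. The correction \<open>c\<close> is used with value 1 for
  \<open>x\<close> in \<open>S\<close>, where every line counts \<open>x\<close> once, and with
  value 0 for \<open>x\<close> outside \<open>S\<close>.\<close>

lemma sum_pencil_t_secants:
  fixes c :: int
  assumes "x \<in> points"
  shows "(\<Sum>l \<in> pencil x. int (card (l \<inter> S)) - c)
    = int (card (pencil x \<inter> t_secants)) * (int t - int m) + (int q + 1) * (int m - c)"
proof -
  have "(\<Sum>l \<in> pencil x. int (card (l \<inter> S)) - c)
      = (\<Sum>l \<in> pencil x. (if l \<in> t_secants then int t - int m else 0) + (int m - c))"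
    using secant_cases unfolding t_secants_def pencil_def by (intro sum.cong) auto
  also have "\<dots> = int (card (pencil x \<inter> t_secants)) * (int t - int m) + (int q + 1) * (int m - c)"
    using card_pencil[OF assms]
    by (simp add: sum.distrib sum_subtractf sum.If_cases Int_def distrib_right distrib_left
        right_diff_distrib left_diff_distrib)
  finally show ?thesis .
qed

lemma finite_S: "finite S"
  using S_psubset finite_points finite_subset by blast

text \<open>The product form leaves open the case \<open>m = t\<close>, which is excluded only
  later, by the count at a point outside \<open>S\<close>.\<close>

lemma t_secants_through_inner_point_aux:
  assumes "x \<in> S"
  shows "(int (card (pencil x \<inter> t_secants)) - 1) * (int t - int m) = 0"
proof -
  have x: "x \<in> points" using assms S_psubset by blast
  have "int (card S) - 1 = int (card (S - {x}))"
    using assms finite_S card.remove[of S x] by simp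
  also have "\<dots> = (\<Sum>l \<in> pencil x. int (card (l \<inter> S - {x})))"
    using card_Diff_eq_sum_pencil[OF x] S_psubset by auto
  also have "\<dots> = (\<Sum>l \<in> pencil x. int (card (l \<inter> S)) - 1)"
    using assms secant_pos unfolding pencil_def
    by (intro sum.cong) (auto simp: card_Diff_singleton_if of_nat_diff Suc_leI)
  finally show ?thesis
    unfolding sum_pencil_t_secants[OF x] using card_S by (simp add: algebra_simps)
qed

lemma t_secants_through_outer_point:
  assumes "x \<in> points - S"
  shows "(int (card (pencil x \<inter> t_secants)) - 1) * (int m - int t) = int q"
proof -
  have x: "x \<in> points" "x \<notin> S" using assms by auto
  have "int (card S) = (\<Sum>l \<in> pencil x. int (card (l \<inter> S)) - 0)"
    using card_Diff_eq_sum_pencil[OF x(1), of S] S_psubset x(2) by auto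
  then show ?thesis
    unfolding sum_pencil_t_secants[OF x(1)] using card_S by (simp add: algebra_simps)
qed

lemma outer_point: obtains z where "z \<in> points - S"
  using S_psubset by blast

lemma m_neq_t: "m \<noteq> t"
proof -
  obtain z where "z \<in> points - S" using outer_point .
  from t_secants_through_outer_point[OF this] show ?thesis using q_pos by auto
qed

lemma t_secants_through_inner_point:
  assumes "x \<in> S"
  shows "card (pencil x \<inter> t_secants) = 1"
  using t_secants_through_inner_point_aux[OF assms] m_neq_t by simp

lemma t_secants_meet_outside:
  assumes "k \<in> t_secants" "l \<in> t_secants" "k \<noteq> l" "x \<in> k" "x \<in> l"
  shows "x \<notin> S"
proof
  assume "x \<in> S"
  then have "card (pencil x \<inter> t_secants) = 1" by (rule t_secants_through_inner_point)
  moreover have "k \<in> pencil x \<inter> t_secants" "l \<in> pencil x \<inter> t_secants"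
    using assms unfolding t_secants_def pencil_def by auto
  ultimately show False
    using assms(3) by (auto simp: card_1_singleton_iff)
qed

lemma obtain_t_secant: obtains l where "l \<in> t_secants"
proof -
  obtain x where "x \<in> S" using S_nonempty by blast
  then have "pencil x \<inter> t_secants \<noteq> {}"
    using t_secants_through_inner_point by fastforce
  then show ?thesis using that by blast
qed

lemma t_pos: "t > 0"
proof -
  obtain l where "l \<in> t_secants" using obtain_t_secant .
  then show ?thesis using secant_pos[of l] unfolding t_secants_def by auto
qed

text \<open>A point of \<open>S\<close> lies on a single t-secant but on at least two lines, so
  m-secants do occur, and no line misses \<open>S\<close>.\<close>

lemma m_pos: "m > 0"
proof -
  obtain x where x: "x \<in> S" using S_nonempty by blast
  have "card (pencil x) = q + 1"
    using x S_psubset card_pencil(1) by blast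
  then have "pencil x \<inter> t_secants \<noteq> pencil x"
    using t_secants_through_inner_point[OF x] q_pos by auto
  then obtain l where "l \<in> lines" "card (l \<inter> S) \<noteq> t"
    unfolding t_secants_def pencil_def by blast
  then show ?thesis using secant_cases[of l] secant_pos[of l] by auto
qed

lemma card_S_eq_t_secants: "card S = card t_secants * t"
proof -
  have "S \<subseteq> (\<Union>l \<in> t_secants. l \<inter> S)"
  proof
    fix x assume x: "x \<in> S"
    then obtain l where "l \<in> pencil x \<inter> t_secants"
      using t_secants_through_inner_point by (metis card_1_singletonE singletonI)
    then show "x \<in> (\<Union>l \<in> t_secants. l \<inter> S)"
      using x unfolding pencil_def by blast
  qed
  then have "S = (\<Union>l \<in> t_secants. l \<inter> S)" by blast
  moreover have "card (\<Union>l \<in> t_secants. l \<inter> S) = (\<Sum>l \<in> t_secants. card (l \<inter> S))"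
  proof (rule card_UN_disjoint)
    show "\<forall>k \<in> t_secants. \<forall>l \<in> t_secants. k \<noteq> l \<longrightarrow> (k \<inter> S) \<inter> (l \<inter> S) = {}"
      using t_secants_meet_outside by blast
  qed (use finite_lines finite_S in \<open>auto simp: t_secants_def\<close>)
  moreover have "(\<Sum>l \<in> t_secants. card (l \<inter> S)) = card t_secants * t"
    by (simp add: t_secants_def)
  ultimately show ?thesis by simp
qed

text \<open>Every other t-secant meets a fixed one in exactly one of its \<open>q + 1 - t\<close>
  points outside \<open>S\<close>, and each of these points carries \<open>e\<close> further
  t-secants.\<close>

lemma card_t_secants:
  assumes "\<And>x. x \<in> points - S \<Longrightarrow> card (pencil x \<inter> t_secants) = e + 1"
  shows "card t_secants = 1 + (q + 1 - t) * e"
proof -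
  obtain l where l: "l \<in> t_secants" using obtain_t_secant .
  then have l': "l \<in> lines" "card (l \<inter> S) = t" unfolding t_secants_def by auto
  have "t_secants - {l} \<subseteq> (\<Union>x \<in> l - S. pencil x \<inter> t_secants - {l})"
  proof
    fix k assume k: "k \<in> t_secants - {l}"
    then have "k \<in> lines" unfolding t_secants_def by blast
    then obtain x where "x \<in> k" "x \<in> l"
      using unique_meet[of k l] k l' by blast
    then show "k \<in> (\<Union>x \<in> l - S. pencil x \<inter> t_secants - {l})"
      using k l t_secants_meet_outside[of k l x] \<open>k \<in> lines\<close> unfolding pencil_def by blast
  qed
  then have "t_secants - {l} = (\<Union>x \<in> l - S. pencil x \<inter> t_secants - {l})" by blast
  moreover have "card (\<Union>x \<in> l - S. pencil x \<inter> t_secants - {l})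
      = (\<Sum>x \<in> l - S. card (pencil x \<inter> t_secants - {l}))"
  proof (rule card_UN_disjoint)
    show "\<forall>x \<in> l - S. \<forall>y \<in> l - S. x \<noteq> y \<longrightarrow>
        (pencil x \<inter> t_secants - {l}) \<inter> (pencil y \<inter> t_secants - {l}) = {}"
      using line_eqI l' unfolding pencil_def by blast
  qed (use finite_lines finite_line[OF l'(1)] in \<open>auto simp: t_secants_def\<close>)
  moreover have "card (pencil x \<inter> t_secants - {l}) = e" if "x \<in> l - S" for x
  proof -
    have "l \<in> pencil x \<inter> t_secants" using that l l'(1) by (simp add: pencil_def)
    moreover have "x \<in> points - S" using that lines_subset l'(1) by blast
    ultimately show ?thesis using assms by (simp add: card_Diff_singleton)
  qed
  moreover have "card (l - S) = q + 1 - t"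
    using l' card_line finite_line by (simp add: card_Diff_subset_Int)
  ultimately have "card (t_secants - {l}) = (q + 1 - t) * e" by simp
  moreover have "finite t_secants"
    using finite_lines by (simp add: t_secants_def)
  then have "card t_secants = 1 + card (t_secants - {l})"
    using l card.remove[of t_secants l] by simp
  ultimately show ?thesis by simp
qed

lemma t_le: "t \<le> q + 1"
proof -
  obtain l where "l \<in> t_secants" using obtain_t_secant .
  then show ?thesis
    unfolding t_secants_def using card_line card_mono[OF finite_line, of l "l \<inter> S"] by auto
qed

text \<open>As \<open>m - t\<close> is negative, the count at an outer point allows no t-secant
  there, whence \<open>t = q + m\<close>. A line has only \<open>q + 1\<close> points, so
  \<open>m = 1\<close>, and a t-secant lies in \<open>S\<close> and has its size.\<close>

lemma line_if_m_less_t: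
  assumes "m < t"
  shows "m = 1" "S \<in> lines"
proof -
  obtain z where z: "z \<in> points - S" using outer_point .
  define b where "b = card (pencil z \<inter> t_secants)"
  have b: "(int b - 1) * (int m - int t) = int q"
    using t_secants_through_outer_point[OF z] unfolding b_def .
  have "b = 0"
  proof (rule ccontr)
    assume "b \<noteq> 0"
    then have "(int b - 1) * (int m - int t) \<le> 0"
      using assms by (intro mult_nonneg_nonpos) auto
    then show False using b q_pos by simp
  qed
  then have tq: "t = q + m" using b by simp
  then show m1: "m = 1" using t_le m_pos by simp
  obtain l where l: "l \<in> lines" "card (l \<inter> S) = t"
    using obtain_t_secant unfolding t_secants_def by blast
  then have "l \<inter> S = l"
    using tq m1 card_line finite_line by (intro card_subset_eq) auto
  moreover have "card S = t" using card_S m1 by simp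
  ultimately have "l = S"
    using l finite_S by (intro card_subset_eq) auto
  then show "S \<in> lines" using l by simp
qed

lemma KM_equation:
  assumes "t < m"
  obtains d e where "m = t + d" "d > 0" "q = d * e"
    "\<And>x. x \<in> points - S \<Longrightarrow> card (pencil x \<inter> t_secants) = e + 1"
    "t * t + t * d + d * d = t * d * e + t + d"
proof -
  define d where "d = m - t"
  have md: "m = t + d" "d > 0" using assms by (auto simp: d_def)
  obtain z where z: "z \<in> points - S" using outer_point .
  \<comment> \<open>The subtraction does not truncate: a count of 0 would turn \<open>zd\<close>
    into \<open>- d = q\<close>. That \<open>e\<close> does not depend on \<open>z\<close> follows
    by cancelling \<open>d\<close>.\<close>
  define e where "e = card (pencil z \<inter> t_secants) - 1"
  have zd: "(int (card (pencil x \<inter> t_secants)) - 1) * int d = int q" if "x \<in> points - S" for x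
    using t_secants_through_outer_point[OF that] md by simp
  have "card (pencil z \<inter> t_secants) > 0"
  proof (rule ccontr)
    assume "\<not> ?thesis"
    then show False using zd[OF z] q_pos by simp
  qed
  then have ez: "int (card (pencil z \<inter> t_secants)) - 1 = int e" by (simp add: e_def)
  then have "int e * int d = int q" using zd[OF z] by simp
  then have q: "q = d * e" by (metis mult.commute of_nat_eq_iff of_nat_mult)
  have out: "card (pencil x \<inter> t_secants) = e + 1" if "x \<in> points - S" for x
  proof -
    have "(int (card (pencil x \<inter> t_secants)) - 1) * int d = int e * int d"
      using zd[OF that] zd[OF z] ez by simp
    then show ?thesis using md(2) by simp
  qed
  have "card t_secants = 1 + (q + 1 - t) * e"
    by (rule card_t_secants) (rule out)
  then have "int (card t_secants) = 1 + (int q + 1 - int t) * int e"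
    using t_le by (simp add: of_nat_diff)
  then have "int (card S) = (1 + (int q + 1 - int t) * int e) * int t"
    using card_S_eq_t_secants by simp
  \<comment> \<open>Both expressions for the size of \<open>S\<close> contain the summand
    \<open>t\<close>; without it, and with \<open>q = d * e\<close>, both sides are multiples of
    \<open>e\<close>.\<close>
  then have "int e * (int d * (int t + int d - 1)) = int e * ((int q + 1 - int t) * int t)"
    using card_S md(1) q by (simp add: algebra_simps)
  moreover have "e > 0" using q q_pos by (cases e) auto
  ultimately have "int d * (int t + int d - 1) = (int q + 1 - int t) * int t" by simp
  then have "int (t * t + t * d + d * d) = int (t * d * e + t + d)"
    using q by (simp add: algebra_simps)
  then have "t * t + t * d + d * d = t * d * e + t + d"
    by (simp only: of_nat_eq_iff)
  with md q out show ?thesis by (rule that)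
qed

text \<open>A t-secant has \<open>q + 1 - t = d + 1\<close> points outside \<open>S\<close>, while
  an m-secant has only one because \<open>m = q\<close>. So the join of two points outside
  \<open>S\<close> is always a t-secant.\<close>

lemma baer_complement:
  assumes "d \<ge> 2" "q = d * d" "t = d * (d - 1)" "m = q"
    and out: "\<And>x. x \<in> points - S \<Longrightarrow> card (pencil x \<inter> t_secants) = d + 1"
  shows "subplane_of_order points lines d (points - S)"
proof -
  define B where "B = points - S"
  have trace: "l \<inter> B = l - S" if "l \<in> lines" for l
    using lines_subset[OF that] by (auto simp: B_def)
  have card_trace: "card (l \<inter> B) = q + 1 - card (l \<inter> S)" if "l \<in> lines" for l
    using that card_line finite_line by (simp add: trace card_Diff_subset_Int)
  have sec: "card (l \<inter> B) = d + 1" if "l \<in> t_secants" for l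
  proof -
    have "q = t + d"
      using assms by (cases d) auto
    then show ?thesis using that card_trace unfolding t_secants_def by simp
  qed
  have nonsec: "card (l \<inter> B) = 1" if "l \<in> lines" "l \<notin> t_secants" for l
    using that secant_cases[of l] card_trace assms(4) unfolding t_secants_def by auto
  let ?M = "(\<lambda>l. l \<inter> B) ` t_secants"
  have sl: "l \<in> lines" if "l \<in> t_secants" for l
    using that unfolding t_secants_def by blast
  have "projective_plane B ?M"
  proof
    fix x y assume xy: "x \<in> B" "y \<in> B" "x \<noteq> y"
    then have "x \<in> points" "y \<in> points" by (auto simp: B_def)
    then obtain l where l: "l \<in> lines" "x \<in> l" "y \<in> l"
      using unique_join xy(3) by blast
    have "l \<in> t_secants"
    proof (rule ccontr)
      assume "l \<notin> t_secants"
      then have "card (l \<inter> B) = 1" using nonsec l by blast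
      then show False using l xy by (metis IntI card_1_singletonE singletonD)
    qed
    then show "\<exists>!l. l \<in> ?M \<and> x \<in> l \<and> y \<in> l"
      using l xy line_eqI sl by blast
  next
    fix k l assume "k \<in> ?M" "l \<in> ?M" "k \<noteq> l"
    then obtain k' l' where kl: "k = k' \<inter> B" "l = l' \<inter> B" "k' \<in> t_secants" "l' \<in> t_secants" "k' \<noteq> l'"
      by blast
    then obtain x where x: "x \<in> points" "x \<in> k'" "x \<in> l'"
      using unique_meet sl by blast
    then have "x \<in> B" using t_secants_meet_outside kl unfolding B_def by blast
    then show "\<exists>!x. x \<in> B \<and> x \<in> k \<and> x \<in> l"
      using x kl meet_eqI[of k' l'] sl by blast
  next
    \<comment> \<open>The quadrangle consists of two points on each of two t-secants through
      \<open>z\<close>, all different from \<open>z\<close>; they exist since \<open>d + 1\<close>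
      is at least 3.\<close>
    obtain z where z: "z \<in> B" using outer_point unfolding B_def .
    then have "card (pencil z \<inter> t_secants) \<ge> 2" using out assms(1) unfolding B_def by simp
    then obtain K where "K \<subseteq> pencil z \<inter> t_secants" "card K = 2"
      using obtain_subset_with_card_n by metis
    then obtain k l where kl: "k \<in> t_secants" "l \<in> t_secants" "k \<noteq> l" "z \<in> k" "z \<in> l"
      by (auto simp: card_2_iff pencil_def)
    have two: "\<exists>a b. a \<in> k \<inter> B \<and> b \<in> k \<inter> B \<and> a \<noteq> b \<and> a \<noteq> z \<and> b \<noteq> z"
      if "k \<in> t_secants" for k
    proof -
      have "finite (k \<inter> B)" using finite_line sl[OF that] by blast
      then have "card (k \<inter> B - {z}) \<ge> 2"
        using sec[OF that] assms(1) by (simp add: card_Diff_singleton_if)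
      then obtain A where "A \<subseteq> k \<inter> B - {z}" "card A = 2"
        using obtain_subset_with_card_n by metis
      then show ?thesis by (auto simp: card_2_iff)
    qed
    obtain a b where ab: "a \<in> k \<inter> B" "b \<in> k \<inter> B" "a \<noteq> b" "a \<noteq> z" "b \<noteq> z"
      using two kl by blast
    obtain c e where ce: "c \<in> l \<inter> B" "e \<in> l \<inter> B" "c \<noteq> e" "c \<noteq> z" "e \<noteq> z"
      using two kl by blast
    have nk: "c \<notin> k" "e \<notin> k" "a \<notin> l" "b \<notin> l"
      using ab ce kl sl meet_eqI[of k l z] by blast+
    have "card ({a, b, c, e} \<inter> (n \<inter> B)) \<le> 2" if "n \<in> t_secants" for n
    proof -
      have n: "n \<in> lines" using sl that .
      \<comment> \<open>A line other than \<open>k\<close> and \<open>l\<close> contains at most one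
        of \<open>a\<close>, \<open>b\<close> and at most one of \<open>c\<close>, \<open>e\<close>.
        The conditional witnesses below select these, with an arbitrary default if neither lies on
        \<open>n\<close>.\<close>
      consider "n = k" | "n = l" | "\<not> (a \<in> n \<and> b \<in> n)" "\<not> (c \<in> n \<and> e \<in> n)"
        using line_eqI[OF n sl[OF kl(1)] ab(3)] line_eqI[OF n sl[OF kl(2)] ce(3)] ab ce by blast
      then have "\<exists>u v. {a, b, c, e} \<inter> (n \<inter> B) \<subseteq> {u, v}"
      proof cases
        case 1
        then show ?thesis using nk by (intro exI[of _ a] exI[of _ b]) auto
      next
        case 2
        then show ?thesis using nk by (intro exI[of _ c] exI[of _ e]) auto
      next
        case 3
        then show ?thesis
          by (intro exI[of _ "if a \<in> n then a else b"] exI[of _ "if c \<in> n then c else e"]) auto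
      qed
      then obtain u v where "{a, b, c, e} \<inter> (n \<inter> B) \<subseteq> {u, v}" by blast
      then have "card ({a, b, c, e} \<inter> (n \<inter> B)) \<le> card {u, v}" by (intro card_mono) auto
      also have "\<dots> \<le> 2" by (simp add: card_insert_if)
      finally show ?thesis .
    qed
    moreover have "a \<noteq> c" "a \<noteq> e" "b \<noteq> c" "b \<noteq> e"
      using ab nk by auto
    then have "card {a, b, c, e} = 4"
      using ab(3) ce(3) by simp
    ultimately show "\<exists>Q \<subseteq> B. card Q = 4 \<and> (\<forall>l \<in> ?M. card (Q \<inter> l) \<le> 2)"
      using ab ce by (intro exI[of _ "{a, b, c, e}"]) auto
  qed auto
  then have "projective_plane_of_order B ?M d"
    using sec unfolding projective_plane_of_order_def by auto
  then show ?thesis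
    unfolding subplane_of_order_def B_def using sl by blast
qed

end

section \<open>Identification of the four configurations\<close>

theorem theorem2p6:
  fixes P :: "'a set" and L :: "'a set set" and S :: "'a set" and q m t :: nat
  assumes "projective_plane_of_order P L q"
    and "primepow q"
    and "generalized_KM_arc P L q m t S"
    and "\<not> (\<exists>l. zero_secant L S l)"
  shows
    "(card S = q + 1 \<and> collinear_points L S \<and> m = 1) \<or>
     (unital P L q S \<and> t = 1 \<and> real m = sqrt (real q) + 1) \<or>
     ((\<exists>B. baer_subplane P L q B \<and> S = P - B) \<and> real t = real q - sqrt (real q) \<and> m = q) \<or>
     ((\<exists>x \<in> P. S = P - {x}) \<and> t = q \<and> m = q + 1)"
proof -
  interpret projective_plane P L
    using assms(1) by (simp add: projective_plane_of_order_def)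
  interpret finite_projective_plane P L q
    using assms(1) by unfold_locales (simp add: projective_plane_of_order_def)
  have arc: "S \<subset> P" "S \<noteq> {}" "int (card S) = int q * (int m - 1) + int t"
    "\<And>l. l \<in> L \<Longrightarrow> card (l \<inter> S) \<in> {0, m, t}"
    using assms(3) by (auto simp: generalized_KM_arc_def)
  have pos: "card (l \<inter> S) > 0" if "l \<in> L" for l
    using that assms(4) finite_line[OF that] by (auto simp: zero_secant_def card_gt_0_iff)
  interpret KM_arc_without_zero_secants P L q m t S
  proof
    show "card (l \<inter> S) \<in> {m, t}" if "l \<in> L" for l
      using arc(4)[OF that] pos[OF that] by auto
    show "q > 0" using assms(2) by (simp add: primepow_gt_0_nat)
  qed (use arc pos in auto)
  have SP: "S \<subseteq> P" using arc(1) by blast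
  show ?thesis
  proof (cases "m < t")
    case True
    note line = line_if_m_less_t[OF True]
    then show ?thesis using card_line by (auto simp: collinear_points_def)
  next
    case False
    then have "t < m" using m_neq_t by simp
    then obtain d e where md: "m = t + d" "d > 0" "q = d * e"
      and out: "\<And>x. x \<in> P - S \<Longrightarrow> card (pencil x \<inter> t_secants) = e + 1"
      and eq: "t * t + t * d + d * d = t * d * e + t + d"
      using KM_equation by blast
    have "primepow (d * e)" using assms(2) md(3) by simp
    from KM_parameters[OF this t_pos md(2) eq]
    consider "d = 1" "t = e" | "t = 1" "e = d" | "d \<ge> 2" "e = d" "t = d * (d - 1)" by blast
    then show ?thesis
    proof cases
      case 1
      then have tm: "t = q" "m = q + 1" using md by auto
      obtain z where z: "z \<in> P - S" using outer_point .
      \<comment> \<open>Every line meets \<open>S\<close> in at least \<open>q\<close> of its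
        \<open>q + 1\<close> points, so no line can join two points outside
        \<open>S\<close>.\<close>
      have "x = z" if x: "x \<in> P - S" for x
      proof (rule ccontr)
        assume "x \<noteq> z"
        then obtain l where l: "l \<in> L" "x \<in> l" "z \<in> l"
          using unique_join[of x z] x z by blast
        have "card {x, z} \<le> card (l - S)"
          using l x z finite_line by (intro card_mono) auto
        also have "\<dots> = q + 1 - card (l \<inter> S)"
          using l card_line finite_line by (simp add: card_Diff_subset_Int)
        also have "\<dots> \<le> 1" using secant_cases[OF l(1)] tm by auto
        finally show False using \<open>x \<noteq> z\<close> by simp
      qed
      then have "S = P - {z}" using z SP by blast
      then show ?thesis using z tm by blast
    next
      case 2
      then have r: "sqrt (real q) = real d" using md by (simp add: real_sqrt_mult_self)
      \<comment> \<open>Here \<open>m - 1 = d\<close> is the square root of \<open>q\<close>, so the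
        secant sizes \<open>t = 1\<close> and \<open>m = d + 1\<close> are those of a
        unital.\<close>
      have "card S = q * d + 1"
        using card_S md 2 by (simp flip: of_nat_mult)
      then have "unital P L q S"
        unfolding unital_def r using SP secant_cases md 2 by fastforce
      then show ?thesis using 2 md r by simp
    next
      case 3
      then have r: "sqrt (real q) = real d" using md by (simp add: real_sqrt_mult_self)
      \<comment> \<open>\<open>m = d * (d - 1) + d = d * d\<close>; the case distinction on
        \<open>d\<close> resolves the truncated \<open>d - 1\<close>.\<close>
      have mq: "m = q" using md 3 by (cases d) auto
      have "subplane_of_order P L d (P - S)"
        using baer_complement[of d] 3 md out mq by simp
      then have "baer_subplane P L q (P - S)"
        unfolding baer_subplane_def r by blast
      moreover have "S = P - (P - S)" using SP by blast
      moreover have "real q = real t + real d"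
        using mq md(1) by (metis of_nat_add)
      ultimately show ?thesis using mq r by auto
    qed
  qed
qed

end
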